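(* Let $k$ be a perfect field of characteristic $p>2$, let $S=k[x_1,\dots,x_n]$, and let $I$ be a radical homogeneous ideal in $S$. The ring $S/I$ is $F$-split if and only if the Rees-like algebra $\mathcal{RL}(I)=S[It,t^2]\subseteq S[t]$ is $F$-split.
   Context: A reduced ring $A$ of characteristic $p>0$ is $F$-split if the inclusion $A\subseteq A^{1/p}$ (identified with the Frobenius map) splits as a map of $A$-modules, i.e. there is an $A$-linear map $A^{1/p}\to A$ sending $1$ to $1$. All rings and fields considered are $F$-finite. *)

theory Defs
  imports
    "HOL-Library.Poly_Mapping"
    "HOL-Computational_Algebra.Polynomial"
    "HOL-Algebra.QuotRing"
    "HOL-Algebra.Module"
    "HOL-Algebra.Generated_Rings"
    "HOL-Algebra.Algebraic_Closure_Type"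
begin

section \<open>F-split rings\<close>

definition reduced_ring :: "('a, 'b) ring_scheme \<Rightarrow> bool" where
  "reduced_ring R \<longleftrightarrow>
     cring R \<and> (\<forall>a\<in>carrier R. \<forall>k::nat. a [^]\<^bsub>R\<^esub> k = \<zero>\<^bsub>R\<^esub> \<longrightarrow> a = \<zero>\<^bsub>R\<^esub>)"

definition regular_module :: "('a, 'b) ring_scheme \<Rightarrow> ('a, 'a) module" where
  "regular_module R =
     \<lparr>carrier = carrier R, monoid.mult = monoid.mult R, one = one R, zero = zero R, add = add R,
      module.smult = (\<lambda>a x. a \<otimes>\<^bsub>R\<^esub> x)\<rparr>"

text \<open>
  For a reduced ring of characteristic $p$, raising to the $p$-th power identifies the ring of
  $p$-th roots with the ring itself, and the inclusion with the Frobenius map. The root ring is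
  therefore encoded by the ring \<open>R\<close> itself, where the element \<open>x\<close> stands for its
  $p$-th root and a scalar \<open>a\<close> acts as its $p$-th power.
\<close>

definition root_module :: "nat \<Rightarrow> ('a, 'b) ring_scheme \<Rightarrow> ('a, 'a) module" where
  "root_module p R =
     \<lparr>carrier = carrier R, monoid.mult = monoid.mult R, one = one R, zero = zero R, add = add R,
      module.smult = (\<lambda>a x. (a [^]\<^bsub>R\<^esub> p) \<otimes>\<^bsub>R\<^esub> x)\<rparr>"

definition module_homs ::
  "('a, 'r) ring_scheme \<Rightarrow> ('a, 'b, 'm) module_scheme \<Rightarrow> ('a, 'c, 'n) module_scheme
    \<Rightarrow> ('b \<Rightarrow> 'c) set" where
  "module_homs R M N =
     {h \<in> carrier M \<rightarrow> carrier N.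
        (\<forall>x\<in>carrier M. \<forall>y\<in>carrier M. h (x \<oplus>\<^bsub>M\<^esub> y) = h x \<oplus>\<^bsub>N\<^esub> h y) \<and>
        (\<forall>a\<in>carrier R. \<forall>x\<in>carrier M. h (a \<odot>\<^bsub>M\<^esub> x) = a \<odot>\<^bsub>N\<^esub> h x)}"

text \<open>
  Characteristic $p$ is expressed as the vanishing of $p \cdot 1$, so that the zero ring is
  allowed (and is F-split); for a nonzero ring this is the usual notion, as $p$ is prime.
\<close>

definition F_split :: "nat \<Rightarrow> ('a, 'b) ring_scheme \<Rightarrow> bool" where
  "F_split p R \<longleftrightarrow>
     prime p \<and> reduced_ring R \<and> [p] \<cdot>\<^bsub>R\<^esub> \<one>\<^bsub>R\<^esub> = \<zero>\<^bsub>R\<^esub> \<and>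
     (\<exists>\<phi>\<in>module_homs R (root_module p R) (regular_module R).
        \<phi> \<one>\<^bsub>root_module p R\<^esub> = \<one>\<^bsub>R\<^esub>)"


section \<open>Perfect fields and radical ideals\<close>

definition perfect_field :: "'k::field itself \<Rightarrow> bool" where
  "perfect_field _ \<longleftrightarrow> CHAR('k) = 0 \<or> surj (\<lambda>x::'k. x ^ CHAR('k))"

definition radical_ideal :: "'a set \<Rightarrow> ('a, 'b) ring_scheme \<Rightarrow> bool" where
  "radical_ideal I R \<longleftrightarrow>
     ideal I R \<and> (\<forall>a\<in>carrier R. \<forall>k::nat. a [^]\<^bsub>R\<^esub> k \<in> I \<longrightarrow> a \<in> I)"


section \<open>Polynomial rings and homogeneous ideals\<close>

text \<open>
  A monomial is its finitely supported exponent function, and a polynomial is its finitely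
  supported coefficient function. The variables are indexed from 0, so the polynomial ring
  in \<open>n\<close> variables uses the variables with index below \<open>n\<close>.
\<close>

type_synonym 'k mpoly = "(nat \<Rightarrow>\<^sub>0 nat) \<Rightarrow>\<^sub>0 'k"

definition mpoly_ring :: "nat \<Rightarrow> 'k::field mpoly ring" where
  "mpoly_ring n =
     ring_of_type_algebra\<lparr>carrier := {f. \<forall>m\<in>Poly_Mapping.keys f. Poly_Mapping.keys m \<subseteq> {..<n}}\<rparr>"

definition total_degree :: "(nat \<Rightarrow>\<^sub>0 nat) \<Rightarrow> nat" where
  "total_degree m = (\<Sum>i\<in>Poly_Mapping.keys m. Poly_Mapping.lookup m i)"

definition homogeneous :: "'k::field mpoly \<Rightarrow> bool" where
  "homogeneous f \<longleftrightarrow> (\<exists>d. \<forall>m\<in>Poly_Mapping.keys f. total_degree m = d)"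

definition homogeneous_ideal :: "nat \<Rightarrow> 'k::field mpoly set \<Rightarrow> bool" where
  "homogeneous_ideal n I \<longleftrightarrow>
     (\<exists>H \<subseteq> carrier (mpoly_ring n). (\<forall>h\<in>H. homogeneous h) \<and> I = Idl\<^bsub>mpoly_ring n\<^esub> H)"


section \<open>Rees-like algebras\<close>

definition mpoly_ring_t :: "nat \<Rightarrow> 'k::field mpoly poly ring" where
  "mpoly_ring_t n =
     ring_of_type_algebra\<lparr>carrier := {F. \<forall>i. poly.coeff F i \<in> carrier (mpoly_ring n)}\<rparr>"

text \<open>
  In \<open>'k mpoly poly\<close>, the constant \<open>f\<close> is \<open>[:f:]\<close>, the product of \<open>f\<close> with the new variable
  $t$ is \<open>[:0, f:]\<close>, and the square of $t$ is \<open>[:0, 0, 1:]\<close>.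
\<close>

definition rees_like_algebra :: "nat \<Rightarrow> 'k::field mpoly set \<Rightarrow> 'k mpoly poly ring" where
  "rees_like_algebra n I =
     (mpoly_ring_t n)\<lparr>carrier :=
        generate_ring (mpoly_ring_t n)
          ({[:f:] |f. f \<in> carrier (mpoly_ring n)} \<union> {[:0, f:] |f. f \<in> I} \<union> {[:0, 0, 1:]})\<rparr>"

end

theory Submission
  imports Defs
begin

text \<open>
  Let \<open>S\<close> be the polynomial ring and \<open>R = S[It, t\<^sup>2]\<close>. A polynomial in \<open>t\<close> over \<open>S\<close> belongs to
  \<open>R\<close> if and only if its coefficients of odd index lie in \<open>I\<close> (\<open>generate_ring_rees_like\<close>).

  Suppose that \<open>S/I\<close> is F-split. Since \<open>k\<close> is perfect, \<open>S\<close> is free over its subring of \<open>p\<close>-th powers,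
  and the monomials with exponents below \<open>p\<close>, among them \<open>1\<close>, form a basis. A splitting of
  \<open>S/I\<close> can therefore be lifted to \<open>S\<close> basis element by basis element, with \<open>1\<close> lifted to \<open>1\<close>. This
  gives a splitting \<open>\<phi>\<close> of \<open>S\<close> with \<open>\<phi> ` I \<subseteq> I\<close> (\<open>lift_frobenius_splitting\<close>). It extends to
  \<open>S[t]\<close> by taking the coefficient of \<open>t ^ (p * j)\<close>, after \<open>\<phi>\<close>, to that of \<open>t ^ j\<close>. As \<open>p\<close> is odd, \<open>p * j\<close>
  is odd whenever \<open>j\<close> is, so the extension restricts to \<open>R\<close> (\<open>frobenius_splitting_rees_like\<close>).

  Suppose that \<open>R\<close> is F-split. The conductor of \<open>R\<close> in \<open>S[t]\<close> is \<open>I S[t]\<close>, and a splitting preserves a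
  conductor (\<open>splitting_preserves_conductor\<close>). Hence it induces a splitting of the quotient
  \<open>(S/I)[t\<^sup>2]\<close>, and \<open>S/I\<close> is a direct summand of this quotient
  (\<open>frobenius_splitting_mod_of_rees_like\<close>).

  Both notions of F-splitness are first translated into conditions on maps of polynomials
  (\<open>F_split_type_ring_iff\<close>, \<open>F_split_quotient_iff\<close>), where the quotient is treated by congruences
  modulo \<open>I\<close>.
\<close>

section \<open>Unital subrings of a commutative ring type as ring structures\<close>

abbreviation type_ring :: "'a::comm_ring_1 set \<Rightarrow> 'a ring" where
  "type_ring C \<equiv> ring_of_type_algebra\<lparr>carrier := C\<rparr>"

definition unital_subring :: "'a::comm_ring_1 set \<Rightarrow> bool" where
  "unital_subring C \<longleftrightarrow>
     1 \<in> C \<and> (\<forall>x\<in>C. \<forall>y\<in>C. x - y \<in> C) \<and> (\<forall>x\<in>C. \<forall>y\<in>C. x * y \<in> C)"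

lemma unital_subringD:
  assumes "unital_subring C"
  shows "1 \<in> C" "0 \<in> C" "x \<in> C \<Longrightarrow> y \<in> C \<Longrightarrow> x - y \<in> C" "x \<in> C \<Longrightarrow> - x \<in> C"
    "x \<in> C \<Longrightarrow> y \<in> C \<Longrightarrow> x + y \<in> C" "x \<in> C \<Longrightarrow> y \<in> C \<Longrightarrow> x * y \<in> C" "x \<in> C \<Longrightarrow> x ^ k \<in> C"
proof -
  show 1: "1 \<in> C" using assms by (simp add: unital_subring_def)
  have diff: "x - y \<in> C" if "x \<in> C" "y \<in> C" for x y
    using assms that by (simp add: unital_subring_def)
  show 0: "0 \<in> C" using diff[OF 1 1] by simp
  have neg: "- x \<in> C" if "x \<in> C" for x using diff[OF 0 that] by simp
  show "x + y \<in> C" if "x \<in> C" "y \<in> C" using diff[OF that(1) neg[OF that(2)]] by simp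
  have mult: "x * y \<in> C" if "x \<in> C" "y \<in> C" for x y
    using assms that by (simp add: unital_subring_def)
  show "x ^ k \<in> C" if "x \<in> C" using that by (induction k) (auto intro: 1 mult)
  show "x \<in> C \<Longrightarrow> y \<in> C \<Longrightarrow> x - y \<in> C" "x \<in> C \<Longrightarrow> - x \<in> C" "x \<in> C \<Longrightarrow> y \<in> C \<Longrightarrow> x * y \<in> C"
    by (fact diff neg mult)+
qed

lemma type_ring_simps [simp]:
  "carrier (type_ring C) = C" "x \<oplus>\<^bsub>type_ring C\<^esub> y = x + y" "x \<otimes>\<^bsub>type_ring C\<^esub> y = x * y"
  "\<one>\<^bsub>type_ring C\<^esub> = 1" "\<zero>\<^bsub>type_ring C\<^esub> = 0"
  "x \<oplus>\<^bsub>ring_of_type_algebra\<^esub> y = x + y" "x \<otimes>\<^bsub>ring_of_type_algebra\<^esub> y = x * y"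
  "\<one>\<^bsub>ring_of_type_algebra\<^esub> = 1" "\<zero>\<^bsub>ring_of_type_algebra\<^esub> = 0"
  by (simp_all add: ring_of_type_algebra_def)

lemma type_ring_nat_pow [simp]: "x [^]\<^bsub>type_ring C\<^esub> (k::nat) = x ^ k"
  by (induction k) (simp_all add: nat_pow_def mult.commute)

lemma type_ring_add_pow_one [simp]: "[(k::nat)] \<cdot>\<^bsub>type_ring C\<^esub> 1 = of_nat k"
  by (induction k) (simp_all add: add_pow_def nat_pow_def)

lemma type_ring_cring: "unital_subring C \<Longrightarrow> cring (type_ring C)"
  by (intro cringI abelian_groupI comm_monoidI)
     (auto simp: unital_subringD algebra_simps intro: bexI[of _ "- _"])

lemma type_ring_a_inv:
  assumes "unital_subring C" "x \<in> C"
  shows "\<ominus>\<^bsub>type_ring C\<^esub> x = - x"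
proof -
  interpret cring "type_ring C" by (rule type_ring_cring) fact
  show ?thesis using minus_equality[of "- x" x] assms by (simp add: unital_subringD)
qed

section \<open>Splittings of Frobenius on representatives\<close>

text \<open>
  Linearity over \<open>C\<close> is expressed in the root ring identified with \<open>C\<close>, so that a scalar
  \<open>a\<close> enters as \<open>a ^ p\<close> and leaves as \<open>a\<close>.
\<close>

definition frobenius_splitting :: "nat \<Rightarrow> 'a::comm_ring_1 set \<Rightarrow> ('a \<Rightarrow> 'a) \<Rightarrow> bool" where
  "frobenius_splitting p C \<phi> \<longleftrightarrow>
     \<phi> \<in> C \<rightarrow> C \<and> (\<forall>x\<in>C. \<forall>y\<in>C. \<phi> (x + y) = \<phi> x + \<phi> y) \<and>
     (\<forall>a\<in>C. \<forall>x\<in>C. \<phi> (a ^ p * x) = a * \<phi> x) \<and> \<phi> 1 = 1"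

lemma F_split_type_ring_iff:
  fixes C :: "'a::idom set"
  assumes "unital_subring C" "prime p" "of_nat p = (0::'a)"
  shows "F_split p (type_ring C) \<longleftrightarrow> (\<exists>\<phi>. frobenius_splitting p C \<phi>)"
proof -
  have "reduced_ring (type_ring C)"
    using type_ring_cring[OF assms(1)] by (simp add: reduced_ring_def)
  thus ?thesis using assms(2,3)
    by (auto simp: F_split_def module_homs_def root_module_def regular_module_def
          frobenius_splitting_def Bex_def)
qed

text \<open>
  A map on cosets is awkward to compute with. A splitting for the quotient by \<open>I\<close> is the same as a
  map of representatives that satisfies the conditions of a splitting up to elements of \<open>I\<close>; such a
  map need not be additive, and preserving \<open>I\<close> is what makes it descend to cosets.
\<close>

definition frobenius_splitting_mod ::
    "nat \<Rightarrow> 'a::comm_ring_1 set \<Rightarrow> 'a set \<Rightarrow> ('a \<Rightarrow> 'a) \<Rightarrow> bool" where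
  "frobenius_splitting_mod p C I \<phi> \<longleftrightarrow>
     \<phi> \<in> C \<rightarrow> C \<and> \<phi> \<in> I \<rightarrow> I \<and> (\<forall>x\<in>C. \<forall>y\<in>C. \<phi> (x + y) - (\<phi> x + \<phi> y) \<in> I) \<and>
     (\<forall>a\<in>C. \<forall>x\<in>C. \<phi> (a ^ p * x) - a * \<phi> x \<in> I) \<and> \<phi> 1 - 1 \<in> I"

lemma type_ring_idealD:
  assumes "unital_subring C" "ideal I (type_ring C)"
  shows "I \<subseteq> C" "0 \<in> I" "x \<in> I \<Longrightarrow> y \<in> I \<Longrightarrow> x + y \<in> I" "x \<in> I \<Longrightarrow> - x \<in> I"
    "x \<in> I \<Longrightarrow> y \<in> I \<Longrightarrow> x - y \<in> I" "x \<in> I \<Longrightarrow> y \<in> C \<Longrightarrow> x * y \<in> I" "x \<in> C \<Longrightarrow> y \<in> I \<Longrightarrow> x * y \<in> I"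
proof -
  interpret ideal I "type_ring C" by fact
  show sub: "I \<subseteq> C" using a_subset by simp
  show "0 \<in> I" using additive_subgroup.zero_closed[OF additive_subgroup_axioms] by simp
  have add: "x + y \<in> I" if "x \<in> I" "y \<in> I" for x y
    using additive_subgroup.a_closed[OF additive_subgroup_axioms that] by simp
  have neg: "- x \<in> I" if "x \<in> I" for x
    using I_l_closed[OF that, of "- 1"] unital_subringD[OF assms(1)] by simp
  show "x - y \<in> I" if "x \<in> I" "y \<in> I" using add[OF that(1) neg[OF that(2)]] by simp
  show "x \<in> I \<Longrightarrow> y \<in> I \<Longrightarrow> x + y \<in> I" "x \<in> I \<Longrightarrow> - x \<in> I" by (fact add neg)+
  show "x \<in> I \<Longrightarrow> y \<in> C \<Longrightarrow> x * y \<in> I" using I_r_closed by simp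
  show "x \<in> C \<Longrightarrow> y \<in> I \<Longrightarrow> x * y \<in> I" using I_l_closed by simp
qed

lemma type_ring_coset_eq_iff:
  assumes "unital_subring C" "ideal I (type_ring C)" "x \<in> C" "y \<in> C"
  shows "I +>\<^bsub>type_ring C\<^esub> x = I +>\<^bsub>type_ring C\<^esub> y \<longleftrightarrow> x - y \<in> I"
proof -
  interpret cring "type_ring C" by (rule type_ring_cring) fact
  have "x \<ominus>\<^bsub>type_ring C\<^esub> y = x - y"
    using assms by (simp add: a_minus_def type_ring_a_inv)
  thus ?thesis using quotient_eq_iff_same_a_r_cos[OF assms(2), of x y] assms(3,4) by simp
qed

lemma carrier_quotient: "carrier (R Quot I) = (\<lambda>x. I +>\<^bsub>R\<^esub> x) ` carrier R"
  by (auto simp: FactRing_simps)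

lemma reduced_ring_quotient:
  assumes C: "unital_subring C" and I: "radical_ideal I (type_ring C)"
  shows "reduced_ring (type_ring C Quot I)"
proof -
  let ?R = "type_ring C"
  have id: "ideal I ?R" using I by (simp add: radical_ideal_def)
  interpret ideal I ?R by fact
  have cr: "cring ?R" by (rule type_ring_cring) fact
  interpret h: ring_hom_cring ?R "?R Quot I" "(+>\<^bsub>?R\<^esub>) I" by (rule rcos_ring_hom_cring[OF cr])
  have "A = \<zero>\<^bsub>?R Quot I\<^esub>"
    if A: "A \<in> carrier (?R Quot I)" and pow: "A [^]\<^bsub>?R Quot I\<^esub> k = \<zero>\<^bsub>?R Quot I\<^esub>" for A and k :: nat
  proof -
    obtain a where a: "a \<in> C" "A = I +>\<^bsub>?R\<^esub> a"
      using A by (auto simp: carrier_quotient)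
    have "I +>\<^bsub>?R\<^esub> (a ^ k) = I +>\<^bsub>?R\<^esub> 0"
      using pow a ring_hom_ring.hom_nat_pow[OF rcos_ring_hom_ring, of a k] h.hom_zero by simp
    hence "a ^ k \<in> I"
      using type_ring_coset_eq_iff[OF C id, of "a ^ k" 0] a C by (simp add: unital_subringD)
    hence "a \<in> I" using I a(1) by (auto simp: radical_ideal_def)
    hence "I +>\<^bsub>?R\<^esub> a = I +>\<^bsub>?R\<^esub> 0"
      using type_ring_coset_eq_iff[OF C id, of a 0] a C by (simp add: unital_subringD)
    thus ?thesis using a h.hom_zero by simp
  qed
  thus ?thesis using h.S.is_cring by (auto simp: reduced_ring_def)
qed

text \<open>
  From left to right, a representative is chosen in the image of every coset. From right to left,
  almost-additivity together with \<open>\<phi> ` I \<subseteq> I\<close> shows that the coset of \<open>\<phi> x\<close> depends only on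
  the coset of \<open>x\<close>.
\<close>

lemma F_split_quotient_iff:
  fixes C :: "'a::comm_ring_1 set"
  assumes C: "unital_subring C" and p: "prime p" "of_nat p = (0::'a)"
    and I: "radical_ideal I (type_ring C)"
  shows "F_split p (type_ring C Quot I) \<longleftrightarrow> (\<exists>\<phi>. frobenius_splitting_mod p C I \<phi>)"
proof -
  let ?R = "type_ring C"
  let ?Q = "?R Quot I"
  let ?c = "\<lambda>x. I +>\<^bsub>?R\<^esub> x"
  have id: "ideal I ?R" using I by (simp add: radical_ideal_def)
  interpret ideal I ?R by fact
  have cr: "cring ?R" by (rule type_ring_cring) fact
  interpret h: ring_hom_cring ?R ?Q ?c by (rule rcos_ring_hom_cring[OF cr])
  note eq = type_ring_coset_eq_iff[OF C id]
  note CD = unital_subringD[OF C] and ID = type_ring_idealD[OF C id]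
  have carr: "A \<in> carrier ?Q \<longleftrightarrow> (\<exists>a\<in>C. A = ?c a)" for A
    by (auto simp: carrier_quotient)
  have inQ: "?c a \<in> carrier ?Q" if "a \<in> C" for a using that carr by blast
  have add: "?c (a + b) = ?c a \<oplus>\<^bsub>?Q\<^esub> ?c b" if "a \<in> C" "b \<in> C" for a b
    using h.hom_add[of a b] that by simp
  have mul: "?c (a * b) = ?c a \<otimes>\<^bsub>?Q\<^esub> ?c b" if "a \<in> C" "b \<in> C" for a b
    using h.hom_mult[of a b] that by simp
  have pow: "?c (a ^ k) = ?c a [^]\<^bsub>?Q\<^esub> k" if "a \<in> C" for a and k :: nat
    using ring_hom_ring.hom_nat_pow[OF rcos_ring_hom_ring, of a k] that by simp
  have one: "\<one>\<^bsub>?Q\<^esub> = ?c 1" using h.hom_one by simp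
  have zero: "?c x = ?c 0 \<longleftrightarrow> x \<in> I" if "x \<in> C" for x using eq[OF that CD(2)] by simp
  have of_nat: "[k] \<cdot>\<^bsub>?Q\<^esub> \<one>\<^bsub>?Q\<^esub> = ?c (of_nat k)" for k :: nat
  proof (induction k)
    case 0
    show ?case using h.hom_zero by (simp add: add_pow_def nat_pow_def)
  next
    case (Suc k)
    have "of_nat k \<in> C" by (induction k) (auto intro: CD)
    thus ?case using Suc add[of "of_nat k" 1] CD(1) one
      by (simp add: add.commute)
  qed
  have char: "[p] \<cdot>\<^bsub>?Q\<^esub> \<one>\<^bsub>?Q\<^esub> = \<zero>\<^bsub>?Q\<^esub>"
    using of_nat p(2) h.hom_zero by simp
  have "(\<exists>\<psi>\<in>module_homs ?Q (root_module p ?Q) (regular_module ?Q). \<psi> \<one>\<^bsub>root_module p ?Q\<^esub> = \<one>\<^bsub>?Q\<^esub>)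
      \<longleftrightarrow> (\<exists>\<phi>. frobenius_splitting_mod p C I \<phi>)" (is "?lhs \<longleftrightarrow> ?rhs")
  proof
    assume ?lhs
    then obtain \<psi> where \<psi>: "\<psi> \<in> carrier ?Q \<rightarrow> carrier ?Q" "\<psi> (?c 1) = ?c 1"
        "\<And>A B. A \<in> carrier ?Q \<Longrightarrow> B \<in> carrier ?Q \<Longrightarrow> \<psi> (A \<oplus>\<^bsub>?Q\<^esub> B) = \<psi> A \<oplus>\<^bsub>?Q\<^esub> \<psi> B"
        "\<And>A B. A \<in> carrier ?Q \<Longrightarrow> B \<in> carrier ?Q \<Longrightarrow> \<psi> (A [^]\<^bsub>?Q\<^esub> p \<otimes>\<^bsub>?Q\<^esub> B) = A \<otimes>\<^bsub>?Q\<^esub> \<psi> B"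
      by (auto simp: module_homs_def root_module_def regular_module_def one)
    have "\<forall>x\<in>C. \<exists>y\<in>C. \<psi> (?c x) = ?c y"
      using \<psi>(1) inQ carr by blast
    then obtain \<phi> where \<phi>: "\<And>x. x \<in> C \<Longrightarrow> \<phi> x \<in> C" "\<And>x. x \<in> C \<Longrightarrow> \<psi> (?c x) = ?c (\<phi> x)"
      by metis
    have 1: "\<phi> (x + y) - (\<phi> x + \<phi> y) \<in> I" if "x \<in> C" "y \<in> C" for x y
      using that \<psi>(3)[of "?c x" "?c y"] by (simp add: inQ \<phi> CD eq flip: add)
    have 2: "\<phi> (a ^ p * x) - a * \<phi> x \<in> I" if "a \<in> C" "x \<in> C" for a x
      using that \<psi>(4)[of "?c a" "?c x"] by (simp add: inQ \<phi> CD eq flip: mul pow)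
    have 3: "\<phi> 1 - 1 \<in> I" using \<psi>(2) by (simp add: \<phi> CD eq)
    have 4: "\<phi> x \<in> I" if "x \<in> I" for x
    proof -
      have x: "x \<in> C" using that ID by blast
      have p0: "p > 0" using p by (simp add: prime_gt_0_nat)
      \<comment> \<open>The scalar \<open>0\<close> turns \<open>p\<close>-linearity into the vanishing of \<open>\<phi>\<close> at \<open>0\<close> modulo \<open>I\<close>.\<close>
      have "\<phi> 0 \<in> I" using 2[of 0 0] p0 CD by (simp add: power_0_left)
      moreover have "?c (\<phi> x) = ?c (\<phi> 0)"
        using \<phi>(2)[of x] \<phi>(2)[of 0] zero[of x] that x CD by simp
      hence "\<phi> x - \<phi> 0 \<in> I" using x CD \<phi> by (simp add: eq)
      ultimately show ?thesis using ID(3)[of "\<phi> x - \<phi> 0" "\<phi> 0"] by simp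
    qed
    show ?rhs using 1 2 3 4 \<phi>(1) by (auto simp: frobenius_splitting_mod_def intro!: exI[of _ \<phi>])
  next
    assume ?rhs
    then obtain \<phi> where "frobenius_splitting_mod p C I \<phi>" by blast
    hence \<phi>: "\<And>x. x \<in> C \<Longrightarrow> \<phi> x \<in> C" "\<And>x. x \<in> I \<Longrightarrow> \<phi> x \<in> I"
        "\<And>x y. x \<in> C \<Longrightarrow> y \<in> C \<Longrightarrow> \<phi> (x + y) - (\<phi> x + \<phi> y) \<in> I"
        "\<And>a x. a \<in> C \<Longrightarrow> x \<in> C \<Longrightarrow> \<phi> (a ^ p * x) - a * \<phi> x \<in> I" "\<phi> 1 - 1 \<in> I"
      unfolding frobenius_splitting_mod_def by blast+
    define \<psi> where "\<psi> A = ?c (\<phi> (SOME a. a \<in> C \<and> A = ?c a))" for A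
    have \<psi>: "\<psi> (?c x) = ?c (\<phi> x)" if x: "x \<in> C" for x
    proof -
      define a where "a = (SOME a. a \<in> C \<and> ?c x = ?c a)"
      have "a \<in> C \<and> ?c x = ?c a" unfolding a_def by (rule someI[of _ x]) (simp add: x)
      hence a: "a \<in> C" "x - a \<in> I" using x eq by blast+
      have "\<phi> x - (\<phi> (x - a) + \<phi> a) \<in> I" using \<phi>(3)[of "x - a" a] a x CD by simp
      hence "\<phi> x - \<phi> a \<in> I"
        using ID(3)[OF _ \<phi>(2)[OF a(2)], of "\<phi> x - (\<phi> (x - a) + \<phi> a)"] by simp
      hence "?c (\<phi> x) = ?c (\<phi> a)" using eq[of "\<phi> x" "\<phi> a"] \<phi>(1) x a(1) by blast
      thus ?thesis by (simp add: \<psi>_def flip: a_def)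
    qed
    have "\<psi> (A \<oplus>\<^bsub>?Q\<^esub> B) = \<psi> A \<oplus>\<^bsub>?Q\<^esub> \<psi> B"
      if AB: "A \<in> carrier ?Q" "B \<in> carrier ?Q" for A B
    proof -
      obtain a b where ab: "a \<in> C" "b \<in> C" "A = ?c a" "B = ?c b"
        using AB[THEN carr[THEN iffD1]] by (elim bexE)
      have "\<psi> (A \<oplus>\<^bsub>?Q\<^esub> B) = ?c (\<phi> (a + b))"
        unfolding ab(3,4) add[OF ab(1,2), symmetric] by (rule \<psi>[OF CD(5)[OF ab(1,2)]])
      also have "\<dots> = ?c (\<phi> a + \<phi> b)"
        by (rule iffD2[OF eq \<phi>(3)]) (use ab CD(5) \<phi>(1) in blast)+
      also have "\<dots> = \<psi> A \<oplus>\<^bsub>?Q\<^esub> \<psi> B"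
        unfolding ab(3,4) \<psi>[OF ab(1)] \<psi>[OF ab(2)] by (rule add[OF \<phi>(1)[OF ab(1)] \<phi>(1)[OF ab(2)]])
      finally show ?thesis .
    qed
    moreover have "\<psi> (A [^]\<^bsub>?Q\<^esub> p \<otimes>\<^bsub>?Q\<^esub> B) = A \<otimes>\<^bsub>?Q\<^esub> \<psi> B"
      if AB: "A \<in> carrier ?Q" "B \<in> carrier ?Q" for A B
    proof -
      obtain a b where ab: "a \<in> C" "b \<in> C" "A = ?c a" "B = ?c b"
        using AB[THEN carr[THEN iffD1]] by (elim bexE)
      have "\<psi> (A [^]\<^bsub>?Q\<^esub> p \<otimes>\<^bsub>?Q\<^esub> B) = ?c (\<phi> (a ^ p * b))"
        unfolding ab(3,4) pow[OF ab(1), symmetric] mul[OF CD(7)[OF ab(1)] ab(2), symmetric]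
        by (rule \<psi>[OF CD(6)[OF CD(7)[OF ab(1)] ab(2)]])
      also have "\<dots> = ?c (a * \<phi> b)"
        by (rule iffD2[OF eq \<phi>(4)]) (use ab CD(6,7) \<phi>(1) in blast)+
      also have "\<dots> = A \<otimes>\<^bsub>?Q\<^esub> \<psi> B"
        unfolding ab(3,4) \<psi>[OF ab(2)] by (rule mul[OF ab(1) \<phi>(1)[OF ab(2)]])
      finally show ?thesis .
    qed
    moreover have "\<psi> A \<in> carrier ?Q" if A: "A \<in> carrier ?Q" for A
    proof -
      obtain a where "a \<in> C" "A = ?c a" using A[THEN carr[THEN iffD1]] by (elim bexE)
      thus ?thesis using inQ[OF \<phi>(1)] \<psi> by simp
    qed
    ultimately have "\<psi> \<in> module_homs ?Q (root_module p ?Q) (regular_module ?Q)"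
      by (simp add: module_homs_def root_module_def regular_module_def)
    moreover have "\<psi> (?c 1) = ?c 1" using \<psi> \<phi> eq CD by simp
    ultimately show ?lhs by (auto simp: root_module_def one)
  qed
  thus ?thesis using p(1) char reduced_ring_quotient[OF C I] by (simp add: F_split_def)
qed

section \<open>Additivity of Frobenius\<close>

lemma frobenius_add:
  fixes x y :: "'a::comm_ring_1"
  assumes "prime p" "of_nat p = (0::'a)"
  shows "(x + y) ^ p = x ^ p + y ^ p"
proof -
  have "CHAR('a) dvd p" using assms(2) of_nat_eq_0_iff_char_dvd by blast
  moreover have "CHAR('a) \<noteq> 1" using of_nat_CHAR[where ?'a='a] by auto
  ultimately have "CHAR('a) = p" using assms(1) prime_nat_iff by blast
  thus ?thesis using freshmans_dream[where ?'a='a, of p x y] assms(1) by blast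
qed

lemma frobenius_sum:
  fixes f :: "'b \<Rightarrow> 'a::comm_ring_1"
  assumes "prime p" "of_nat p = (0::'a)"
  shows "(\<Sum>i\<in>A. f i) ^ p = (\<Sum>i\<in>A. f i ^ p)"
  using assms by (induction A rule: infinite_finite_induct)
    (auto simp: frobenius_add power_0_left prime_gt_0_nat)

lemma of_nat_poly_mapping_eq_0:
  "of_nat p = (0::'k::comm_ring_1) \<Longrightarrow> of_nat p = (0::'a::comm_monoid_add \<Rightarrow>\<^sub>0 'k)"
  by (metis single_of_nat single_zero)

lemma of_nat_poly_eq_0:
  "of_nat p = (0::'a::comm_ring_1) \<Longrightarrow> of_nat p = (0::'a poly)"
  by (simp add: of_nat_poly)

section \<open>Roots in a perfect field and division of exponents by \<open>p\<close>\<close>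

definition pth_root :: "nat \<Rightarrow> 'k::field \<Rightarrow> 'k" where
  "pth_root p = inv_into UNIV (\<lambda>x. x ^ p)"

context
  fixes p :: nat
  assumes CHAR: "CHAR('k::field) = p" and prime: "prime p" and perfect: "perfect_field TYPE('k)"
begin

lemma pth_root_power: "pth_root p (c::'k) ^ p = c"
proof -
  have "surj (\<lambda>x::'k. x ^ p)"
    using perfect CHAR prime by (auto simp: perfect_field_def)
  thus ?thesis unfolding pth_root_def by (rule surj_f_inv_f)
qed

text \<open>
  Two \<open>p\<close>-th roots of the same element differ by an element whose \<open>p\<close>-th power is zero.
  Every algebraic property of the root follows from this uniqueness.
\<close>

lemma pth_root_unique:
  assumes "(c::'k) ^ p = d"
  shows "pth_root p d = c"
proof -
  have 0: "of_nat p = (0::'k)" using CHAR by (metis of_nat_CHAR)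
  have "(pth_root p d - c + c) ^ p = (pth_root p d - c) ^ p + c ^ p"
    by (rule frobenius_add[OF prime 0])
  hence "(pth_root p d - c) ^ p = 0" using assms pth_root_power[of d] by simp
  thus ?thesis by simp
qed

lemma pth_root_add: "pth_root p (c + d :: 'k) = pth_root p c + pth_root p d"
proof -
  have 0: "of_nat p = (0::'k)" using CHAR by (metis of_nat_CHAR)
  show ?thesis by (rule pth_root_unique) (simp add: frobenius_add[OF prime 0] pth_root_power)
qed

lemma pth_root_power_mult: "pth_root p (c ^ p * d :: 'k) = c * pth_root p d"
  by (rule pth_root_unique) (simp add: power_mult_distrib pth_root_power)

lemma pth_root_0: "pth_root p (0 :: 'k) = 0"
  by (rule pth_root_unique) (simp add: prime prime_gt_0_nat)

lemma pth_root_1: "pth_root p (1 :: 'k) = 1"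
  by (rule pth_root_unique) simp

end

text \<open>
  Division with remainder by \<open>p\<close> in every exponent writes each monomial uniquely as the \<open>p\<close>-th power
  of a monomial times a monomial with all exponents below \<open>p\<close>. Over a perfect field the latter
  monomials are therefore a basis of the polynomial ring over its subring of \<open>p\<close>-th powers.
\<close>

definition div_exp :: "nat \<Rightarrow> (nat \<Rightarrow>\<^sub>0 nat) \<Rightarrow> (nat \<Rightarrow>\<^sub>0 nat)" where
  "div_exp p m = Poly_Mapping.map (\<lambda>k. k div p) m"

definition mod_exp :: "nat \<Rightarrow> (nat \<Rightarrow>\<^sub>0 nat) \<Rightarrow> (nat \<Rightarrow>\<^sub>0 nat)" where
  "mod_exp p m = Poly_Mapping.map (\<lambda>k. k mod p) m"

definition scale_exp :: "nat \<Rightarrow> (nat \<Rightarrow>\<^sub>0 nat) \<Rightarrow> (nat \<Rightarrow>\<^sub>0 nat)" where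
  "scale_exp p m = Poly_Mapping.map (\<lambda>k. p * k) m"

lemma lookup_exp [simp]:
  "Poly_Mapping.lookup (div_exp p m) i = Poly_Mapping.lookup m i div p"
  "Poly_Mapping.lookup (mod_exp p m) i = Poly_Mapping.lookup m i mod p"
  "Poly_Mapping.lookup (scale_exp p m) i = p * Poly_Mapping.lookup m i"
  by (simp_all add: div_exp_def mod_exp_def scale_exp_def Poly_Mapping.map.rep_eq when_def)

lemma keys_exp:
  "Poly_Mapping.keys (div_exp p m) \<subseteq> Poly_Mapping.keys m"
  "Poly_Mapping.keys (mod_exp p m) \<subseteq> Poly_Mapping.keys m"
  by (auto simp: in_keys_iff intro!: Nat.gr0I)

lemma exp_division: "scale_exp p (div_exp p m) + mod_exp p m = m"
  by (rule poly_mapping_eqI) (simp add: lookup_add)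

lemma exp_division_unique:
  assumes "p > 0"
  shows "div_exp p (scale_exp p u + m) = u + div_exp p m"
    "mod_exp p (scale_exp p u + m) = mod_exp p m"
  using assms by (auto intro!: poly_mapping_eqI simp: lookup_add)

lemma power_single:
  fixes c :: "'k::comm_semiring_1"
  shows "Poly_Mapping.single u c ^ k = Poly_Mapping.single (scale_exp k u) (c ^ k)"
proof (induction k)
  case 0
  have "scale_exp 0 u = 0" by (rule poly_mapping_eqI) simp
  thus ?case by simp
next
  case (Suc k)
  have "u + scale_exp k u = scale_exp (Suc k) u" by (rule poly_mapping_eqI) (simp add: lookup_add)
  thus ?case using Suc by (simp add: mult_single)
qed

lemma poly_mapping_additive_induct [case_names zero single add]:
  fixes f :: "'a \<Rightarrow>\<^sub>0 'b::comm_monoid_add"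
  assumes "P 0"
    and "\<And>m. m \<in> Poly_Mapping.keys f \<Longrightarrow> P (Poly_Mapping.single m (Poly_Mapping.lookup f m))"
    and "\<And>g h. P g \<Longrightarrow> P h \<Longrightarrow> P (g + h)"
  shows "P f"
proof -
  have "P (\<Sum>m\<in>A. Poly_Mapping.single m (Poly_Mapping.lookup f m))"
    if "A \<subseteq> Poly_Mapping.keys f" for A
    using finite_subset[OF that finite_keys] that
    by (induction A rule: finite_induct) (use assms in auto)
  hence "P (\<Sum>m\<in>Poly_Mapping.keys f. Poly_Mapping.single m (Poly_Mapping.lookup f m))" by blast
  moreover have "(\<Sum>m\<in>Poly_Mapping.keys f. Poly_Mapping.single m (Poly_Mapping.lookup f m)) = f"
    by (rule poly_mapping_eqI)
       (auto simp: lookup_sum lookup_single when_def in_keys_iff)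
  ultimately show ?thesis by (simp only:)
qed

section \<open>Lifting a splitting from a quotient of a polynomial ring\<close>

abbreviation mpoly_carrier :: "nat \<Rightarrow> 'k::field mpoly set" where
  "mpoly_carrier n \<equiv> {f. \<forall>m\<in>Poly_Mapping.keys f. Poly_Mapping.keys m \<subseteq> {..<n}}"

lemma unital_subring_mpoly_carrier: "unital_subring (mpoly_carrier n :: 'k::field mpoly set)"
proof -
  have "x * y \<in> mpoly_carrier n" if "x \<in> mpoly_carrier n" "y \<in> mpoly_carrier n" for x y :: "'k mpoly"
  proof (intro CollectI ballI)
    fix m assume "m \<in> Poly_Mapping.keys (x * y)"
    then obtain a b where "m = a + b" "a \<in> Poly_Mapping.keys x" "b \<in> Poly_Mapping.keys y"
      using keys_mult[of x y] by blast
    thus "Poly_Mapping.keys m \<subseteq> {..<n}" using that Poly_Mapping.keys_add[of a b] by blast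
  qed
  moreover have "x - y \<in> mpoly_carrier n"
    if "x \<in> mpoly_carrier n" "y \<in> mpoly_carrier n" for x y :: "'k mpoly"
    using that keys_diff[of x y] by blast
  moreover have "(1::'k mpoly) \<in> mpoly_carrier n" by (auto simp flip: single_one)
  ultimately show ?thesis unfolding unital_subring_def by blast
qed

text \<open>
  Over a perfect field of characteristic \<open>p\<close>, this is the unique additive map that turns a scalar
  \<open>a ^ p\<close> into \<open>a\<close> and has the value \<open>r e\<close> on the monomial with exponent \<open>e\<close>, for every \<open>e\<close> with
  all entries below \<open>p\<close>.
\<close>

definition frobenius_lift ::
    "nat \<Rightarrow> ((nat \<Rightarrow>\<^sub>0 nat) \<Rightarrow> 'k::field mpoly) \<Rightarrow> 'k mpoly \<Rightarrow> 'k mpoly" where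
  "frobenius_lift p r f =
     (\<Sum>m\<in>Poly_Mapping.keys f.
        Poly_Mapping.single (div_exp p m) (pth_root p (Poly_Mapping.lookup f m)) * r (mod_exp p m))"

text \<open>
  The polynomial ring is free over its \<open>p\<close>-th powers, hence a map on the quotient by \<open>I\<close> lifts after
  choosing the values on the basis of monomials in their prescribed cosets. The element \<open>1\<close> belongs
  to this basis and its prescribed coset is that of \<open>1\<close>; choosing \<open>1\<close> itself makes the lift a
  splitting. The lift preserves \<open>I\<close> because it agrees modulo \<open>I\<close> with a map that does.
\<close>

lemma lift_frobenius_splitting:
  fixes I :: "'k::field mpoly set"
  assumes CHAR: "CHAR('k) = p" and prime: "prime p" and perfect: "perfect_field TYPE('k)"
    and I: "ideal I (type_ring (mpoly_carrier n))"
    and \<phi>: "frobenius_splitting_mod p (mpoly_carrier n) I \<phi>"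
  shows "\<exists>\<psi>. frobenius_splitting p (mpoly_carrier n) \<psi> \<and> \<psi> \<in> I \<rightarrow> I"
proof -
  define C where "C = (mpoly_carrier n :: 'k mpoly set)"
  have subring: "unital_subring C" unfolding C_def by (rule unital_subring_mpoly_carrier)
  note CD = unital_subringD[OF subring]
  note ID = type_ring_idealD[OF subring I[folded C_def]]
  note root = pth_root_power[OF CHAR prime perfect] pth_root_add[OF CHAR prime perfect]
    pth_root_power_mult[OF CHAR prime perfect] pth_root_0[OF CHAR prime perfect]
    pth_root_1[OF CHAR prime perfect]
  have p0: "p > 0" using prime by (simp add: prime_gt_0_nat)
  have char: "of_nat p = (0::'k mpoly)"
    using CHAR of_nat_CHAR[where ?'a='k] by (intro of_nat_poly_mapping_eq_0) simp
  have \<phi>D: "\<And>x. x \<in> C \<Longrightarrow> \<phi> x \<in> C" "\<And>x. x \<in> I \<Longrightarrow> \<phi> x \<in> I"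
      "\<And>x y. x \<in> C \<Longrightarrow> y \<in> C \<Longrightarrow> \<phi> (x + y) - (\<phi> x + \<phi> y) \<in> I"
      "\<And>a x. a \<in> C \<Longrightarrow> x \<in> C \<Longrightarrow> \<phi> (a ^ p * x) - a * \<phi> x \<in> I" "\<phi> 1 - 1 \<in> I"
    using \<phi>[folded C_def] unfolding frobenius_splitting_mod_def by blast+
  define r where "r a = (if a = 0 then 1 else \<phi> (Poly_Mapping.single a 1))" for a
  define \<psi> where "\<psi> = frobenius_lift p r"
  have \<psi>_single: "\<psi> (Poly_Mapping.single m c) =
      Poly_Mapping.single (div_exp p m) (pth_root p c) * r (mod_exp p m)" for m c
    by (cases "c = 0") (simp_all add: \<psi>_def frobenius_lift_def root)
  have \<psi>_0: "\<psi> 0 = 0" by (simp add: \<psi>_def frobenius_lift_def)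
  have \<psi>_add: "\<psi> (f + g) = \<psi> f + \<psi> g" for f g
    unfolding \<psi>_def frobenius_lift_def
    by (rule setsum_keys_plus_distrib) (simp_all add: root single_add algebra_simps)
  have \<psi>_linear_monomials: "\<psi> (Poly_Mapping.single u c ^ p * Poly_Mapping.single m d) =
      Poly_Mapping.single u c * \<psi> (Poly_Mapping.single m d)" for u c m d
  proof -
    have "\<psi> (Poly_Mapping.single u c ^ p * Poly_Mapping.single m d) =
        Poly_Mapping.single (u + div_exp p m) (c * pth_root p d) * r (mod_exp p m)"
      by (simp add: power_single mult_single \<psi>_single exp_division_unique[OF p0] root)
    also have "Poly_Mapping.single (u + div_exp p m) (c * pth_root p d) =
        Poly_Mapping.single u c * Poly_Mapping.single (div_exp p m) (pth_root p d)"
      by (simp add: mult_single)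
    finally show ?thesis by (simp only: \<psi>_single mult.assoc)
  qed
  have \<psi>_linear_single: "\<psi> (Poly_Mapping.single u c ^ p * f) = Poly_Mapping.single u c * \<psi> f" for u c f
    by (induction f rule: poly_mapping_additive_induct)
       (simp_all only: \<psi>_0 \<psi>_add \<psi>_linear_monomials distrib_left mult_zero_right)
  have \<psi>_linear: "\<psi> (a ^ p * f) = a * \<psi> f" for a f
  proof (induction a rule: poly_mapping_additive_induct)
    case zero
    show ?case using p0 by (simp add: \<psi>_0 power_0_left)
  qed (simp_all only: \<psi>_linear_single frobenius_add[OF prime char] distrib_right \<psi>_add)
  have "r 0 = 1" by (simp add: r_def)
  moreover have "div_exp p 0 = 0" "mod_exp p 0 = 0" by (auto intro!: poly_mapping_eqI)
  ultimately have \<psi>_1: "\<psi> 1 = 1" using \<psi>_single[of 0 1] by (simp add: root)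
  have \<psi>_lift: "\<psi> f \<in> C \<and> \<psi> f - \<phi> f \<in> I" if f: "f \<in> C" for f
  proof -
    have "f \<in> C \<and> \<psi> f \<in> C \<and> \<psi> f - \<phi> f \<in> I"
    proof (induction f rule: poly_mapping_additive_induct)
      case zero
      show ?case using CD(2) ID(4)[OF \<phi>D(2)[OF ID(2)]] by (simp add: \<psi>_0)
    next
      case (single m)
      define c where "c = Poly_Mapping.lookup f m"
      define g where "g = Poly_Mapping.single (div_exp p m) (pth_root p c)"
      define s where "s = Poly_Mapping.single (mod_exp p m) (1::'k)"
      have m: "Poly_Mapping.keys m \<subseteq> {..<n}" using single f unfolding C_def by blast
      have C: "g \<in> C" "s \<in> C" "Poly_Mapping.single m c \<in> C"
        using m keys_exp[of p m] by (auto simp: C_def g_def s_def)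
      have gs: "Poly_Mapping.single m c = g ^ p * s"
        by (simp add: g_def s_def power_single mult_single exp_division root)
      have r: "r (mod_exp p m) - \<phi> s \<in> I \<and> r (mod_exp p m) \<in> C"
      proof (cases "mod_exp p m = 0")
        case True
        thus ?thesis using ID(4)[OF \<phi>D(5)] CD(1) by (simp add: r_def s_def)
      next
        case False
        thus ?thesis using ID(2) \<phi>D(1)[OF C(2)] by (simp add: r_def s_def)
      qed
      have "g * (r (mod_exp p m) - \<phi> s) - (\<phi> (g ^ p * s) - g * \<phi> s) \<in> I"
        using ID(5)[OF ID(7)[OF C(1) conjunct1[OF r]] \<phi>D(4)[OF C(1,2)]] .
      hence "g * r (mod_exp p m) - \<phi> (g ^ p * s) \<in> I" by (simp add: algebra_simps)
      moreover have "\<psi> (Poly_Mapping.single m c) = g * r (mod_exp p m)"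
        by (simp add: \<psi>_single g_def)
      ultimately show ?case
        using C(3) CD(6)[OF C(1) conjunct2[OF r]] by (simp add: gs flip: c_def)
    next
      case (add g h)
      have "(\<psi> g - \<phi> g) + (\<psi> h - \<phi> h) - (\<phi> (g + h) - (\<phi> g + \<phi> h)) \<in> I"
        using ID(5)[OF ID(3) \<phi>D(3)] add by blast
      moreover have "g + h \<in> C" "\<psi> g + \<psi> h \<in> C" using add CD(5) by blast+
      ultimately show ?case by (simp add: \<psi>_add algebra_simps)
    qed
    thus ?thesis by blast
  qed
  have "\<psi> f \<in> I" if "f \<in> I" for f
    using ID(3)[of "\<psi> f - \<phi> f" "\<phi> f"] \<psi>_lift[of f] \<phi>D(2)[OF that] that ID(1)
    by (simp add: subset_iff)
  moreover have "frobenius_splitting p C \<psi>"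
    unfolding frobenius_splitting_def using \<psi>_lift \<psi>_add \<psi>_linear \<psi>_1 by blast
  ultimately show ?thesis unfolding C_def by blast
qed

section \<open>The Rees-like algebra\<close>

definition rees_like_set :: "'a::comm_ring_1 set \<Rightarrow> 'a set \<Rightarrow> 'a poly set" where
  "rees_like_set C I = {F. \<forall>i. coeff F i \<in> C \<and> (odd i \<longrightarrow> coeff F i \<in> I)}"

lemma unital_subring_sum:
  "unital_subring C \<Longrightarrow> (\<And>i. i \<in> A \<Longrightarrow> f i \<in> C) \<Longrightarrow> sum f A \<in> C"
  by (induction A rule: infinite_finite_induct) (auto simp: unital_subringD)

lemma type_ring_ideal_sum:
  "unital_subring C \<Longrightarrow> ideal I (type_ring C) \<Longrightarrow> (\<And>i. i \<in> A \<Longrightarrow> f i \<in> I) \<Longrightarrow> sum f A \<in> I"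
  by (induction A rule: infinite_finite_induct) (auto simp: type_ring_idealD)

context
  fixes C I :: "'a::comm_ring_1 set"
  assumes C: "unital_subring C" and I: "ideal I (type_ring C)"
begin

lemma unital_subring_poly: "unital_subring {F. \<forall>i. coeff F i \<in> C}"
  by (auto simp: unital_subring_def coeff_mult unital_subringD[OF C] intro!: unital_subring_sum[OF C])

lemma unital_subring_rees_like: "unital_subring (rees_like_set C I)"
proof -
  note CD = unital_subringD[OF C] and ID = type_ring_idealD[OF C I]
  have "coeff (F * G) i \<in> I" if "F \<in> rees_like_set C I" "G \<in> rees_like_set C I" "odd i" for F G i
    unfolding coeff_mult
  proof (rule type_ring_ideal_sum[OF C I])
    fix j assume "j \<in> {..i}"
    hence "odd (j + (i - j))" using \<open>odd i\<close> by simp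
    hence "odd j \<or> odd (i - j)" by simp
    thus "coeff F j * coeff G (i - j) \<in> I"
      using that(1,2) ID(6,7) unfolding rees_like_set_def by blast
  qed
  moreover have "coeff (F * G) i \<in> C" if "F \<in> rees_like_set C I" "G \<in> rees_like_set C I" for F G i
    using that CD(6) unfolding coeff_mult by (intro unital_subring_sum[OF C]) (auto simp: rees_like_set_def)
  ultimately have "F * G \<in> rees_like_set C I"
    if "F \<in> rees_like_set C I" "G \<in> rees_like_set C I" for F G
    using that by (simp add: rees_like_set_def)
  moreover have "F - G \<in> rees_like_set C I" if "F \<in> rees_like_set C I" "G \<in> rees_like_set C I" for F G
    using that CD(3) ID(5) by (simp add: rees_like_set_def)
  moreover have "1 \<in> rees_like_set C I"
    using CD ID by (auto simp: rees_like_set_def)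
  ultimately show ?thesis unfolding unital_subring_def by blast
qed

text \<open>
  The even powers of \<open>t\<close> are powers of the generator \<open>t\<^sup>2\<close>, and every term of odd degree is such a
  power times an element of \<open>I\<close> times \<open>t\<close>; conversely, a product of two such polynomials has its
  odd coefficients in \<open>I\<close> since one of two indices with odd sum is odd.
\<close>

lemma generate_ring_rees_like:
  "generate_ring (type_ring {F. \<forall>i. coeff F i \<in> C})
     ({[:f:] |f. f \<in> C} \<union> {[:0, f:] |f. f \<in> I} \<union> {[:0, 0, 1:]}) = rees_like_set C I"
  (is "generate_ring ?T ?H = _")
proof
  note CD = unital_subringD[OF C] and ID = type_ring_idealD[OF C I]
  interpret T: cring ?T by (rule type_ring_cring[OF unital_subring_poly])
  have "?H \<subseteq> rees_like_set C I"
    using CD ID by (auto simp: rees_like_set_def coeff_pCons split: nat.splits)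
  moreover have "rees_like_set C I \<subseteq> carrier ?T" by (auto simp: rees_like_set_def)
  ultimately have "?H \<subseteq> carrier ?T" by blast
  show "generate_ring ?T ?H \<subseteq> rees_like_set C I"
  proof
    fix F assume "F \<in> generate_ring ?T ?H"
    thus "F \<in> rees_like_set C I"
    proof (induction rule: generate_ring.induct)
      case (a_inv h)
      moreover have "\<ominus>\<^bsub>?T\<^esub> h = - h"
        using a_inv.IH by (intro type_ring_a_inv[OF unital_subring_poly]) (auto simp: rees_like_set_def)
      ultimately show ?case using unital_subringD[OF unital_subring_rees_like] by simp
    qed (use unital_subringD[OF unital_subring_rees_like] \<open>?H \<subseteq> rees_like_set C I\<close> in auto)
  qed
  show "rees_like_set C I \<subseteq> generate_ring ?T ?H"
  proof
    fix F assume F: "F \<in> rees_like_set C I"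
    let ?G = "generate_ring ?T ?H"
    have add: "x + y \<in> ?G" if "x \<in> ?G" "y \<in> ?G" for x y
      using generate_ring.eng_add[OF that] by simp
    have mult: "x * y \<in> ?G" if "x \<in> ?G" "y \<in> ?G" for x y
      using generate_ring.eng_mult[OF that] by simp
    have const: "[:a:] \<in> ?G" if "a \<in> C" for a using that by (intro generate_ring.incl) auto
    have lin: "[:0, a:] \<in> ?G" if "a \<in> I" for a using that by (intro generate_ring.incl) auto
    have square: "[:0, 0, 1:] \<in> ?G" by (intro generate_ring.incl) auto
    have step: "monom a (i + 2) = [:0, 0, 1:] * monom a i" for a :: 'a and i
      by (simp add: monom_Suc)
    have even: "monom a (2 * k) \<in> ?G" if "a \<in> C" for a k
    proof (induction k)
      case 0
      show ?case using const[OF that] by (simp add: monom_0)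
    next
      case (Suc k)
      thus ?case using step[of a "2 * k"] mult[OF square] by simp
    qed
    have odd: "monom a (2 * k + 1) \<in> ?G" if "a \<in> I" for a k
    proof (induction k)
      case 0
      show ?case using lin[OF that] by (simp add: monom_Suc monom_0)
    next
      case (Suc k)
      thus ?case using step[of a "2 * k + 1"] mult[OF square] by simp
    qed
    have "monom (coeff F i) i \<in> ?G" for i
      using F even[of "coeff F i" "i div 2"] odd[of "coeff F i" "i div 2"]
      by (cases "even i") (auto simp: rees_like_set_def)
    moreover have "sum f A \<in> ?G" if "\<And>i. f i \<in> ?G" for f :: "nat \<Rightarrow> 'a poly" and A
      by (induction A rule: infinite_finite_induct) (use const[OF CD(2)] add that in auto)
    ultimately have "(\<Sum>i\<le>degree F. monom (coeff F i) i) \<in> ?G" by simp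
    thus "F \<in> ?G" by (simp add: poly_as_sum_of_monoms)
  qed
qed

end

section \<open>From the base ring to the Rees-like algebra\<close>

text \<open>
  The root of \<open>t ^ k\<close> is sent to \<open>t ^ (k div p)\<close> if \<open>p\<close> divides \<open>k\<close> and to zero otherwise; on
  coefficients the map acts by \<open>\<phi>\<close>. If \<open>p\<close> is positive and \<open>\<phi> 0 = 0\<close>, then stopping at the degree
  loses nothing, because \<open>j \<le> p * j\<close>.
\<close>

definition frobenius_extension :: "nat \<Rightarrow> ('a::comm_ring_1 \<Rightarrow> 'a) \<Rightarrow> 'a poly \<Rightarrow> 'a poly" where
  "frobenius_extension p \<phi> F = (\<Sum>j\<le>degree F. monom (\<phi> (coeff F (p * j))) j)"

lemma coeff_frobenius_extension:
  assumes "p > 0" "\<phi> 0 = 0"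
  shows "coeff (frobenius_extension p \<phi> F) j = \<phi> (coeff F (p * j))"
proof -
  have "coeff F (p * j) = 0" if "\<not> j \<le> degree F"
  proof (rule coeff_eq_0)
    have "j \<le> p * j" using assms(1) by simp
    thus "p * j > degree F" using that by linarith
  qed
  thus ?thesis using assms(2) by (auto simp: frobenius_extension_def coeff_sum)
qed

lemma frobenius_splitting_0:
  "unital_subring C \<Longrightarrow> frobenius_splitting p C \<phi> \<Longrightarrow> \<phi> 0 = 0"
  using unital_subringD(2)[of C] unfolding frobenius_splitting_def
  by (metis add_cancel_right_right)

lemma frobenius_splitting_sum:
  assumes "unital_subring C" "frobenius_splitting p C \<phi>" "\<And>i. i \<in> A \<Longrightarrow> f i \<in> C"
  shows "\<phi> (sum f A) = (\<Sum>i\<in>A. \<phi> (f i))"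
  using assms(3)
proof (induction A rule: infinite_finite_induct)
  case (insert i A)
  moreover have "f i \<in> C" "sum f A \<in> C"
    using insert unital_subring_sum[OF assms(1), of A f] by auto
  ultimately show ?case using assms(2) by (simp add: frobenius_splitting_def)
qed (use assms frobenius_splitting_0 in auto)

lemma coeff_frobenius_power_mult:
  fixes F G :: "'a::comm_ring_1 poly"
  assumes "prime p" "of_nat p = (0::'a)"
  shows "coeff (F ^ p * G) (p * j) =
    (\<Sum>i\<le>degree F. if i \<le> j then coeff F i ^ p * coeff G (p * (j - i)) else 0)"
proof -
  have "F ^ p = (\<Sum>i\<le>degree F. monom (coeff F i) i) ^ p" by (simp add: poly_as_sum_of_monoms)
  also have "\<dots> = (\<Sum>i\<le>degree F. monom (coeff F i ^ p) (p * i))"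
    by (simp only: frobenius_sum[OF assms(1) of_nat_poly_eq_0[OF assms(2)]] monom_power mult.commute)
  finally have "coeff (F ^ p * G) (p * j) =
      (\<Sum>i\<le>degree F. coeff (monom (coeff F i ^ p) (p * i) * G) (p * j))"
    by (simp add: sum_distrib_right coeff_sum)
  thus ?thesis using assms(1)
    by (auto simp: coeff_monom_mult prime_gt_0_nat right_diff_distrib' intro!: sum.cong)
qed

text \<open>
  The Rees-like algebra is stable under the extension by parity: for odd \<open>p\<close> and odd \<open>j\<close>
  the coefficient of index \<open>p * j\<close> lies in \<open>I\<close>, and \<open>\<phi>\<close> keeps it there.
\<close>

lemma frobenius_splitting_rees_like:
  fixes C :: "'a::comm_ring_1 set"
  assumes C: "unital_subring C" and I: "ideal I (type_ring C)"
    and p: "prime p" "odd p" "of_nat p = (0::'a)"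
    and \<phi>: "frobenius_splitting p C \<phi>" "\<phi> \<in> I \<rightarrow> I"
  shows "frobenius_splitting p (rees_like_set C I) (frobenius_extension p \<phi>)"
proof -
  note CD = unital_subringD[OF C]
  have p0: "p > 0" using p(1) by (simp add: prime_gt_0_nat)
  have \<phi>0: "\<phi> 0 = 0" by (rule frobenius_splitting_0[OF C \<phi>(1)])
  have \<phi>D: "\<And>x. x \<in> C \<Longrightarrow> \<phi> x \<in> C" "\<And>x y. x \<in> C \<Longrightarrow> y \<in> C \<Longrightarrow> \<phi> (x + y) = \<phi> x + \<phi> y"
      "\<And>a x. a \<in> C \<Longrightarrow> x \<in> C \<Longrightarrow> \<phi> (a ^ p * x) = a * \<phi> x" "\<phi> 1 = 1"
    using \<phi>(1) unfolding frobenius_splitting_def by blast+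
  note co = coeff_frobenius_extension[of p \<phi>, OF p0 \<phi>0]
  let ?\<Phi> = "frobenius_extension p \<phi>"
  have "?\<Phi> F \<in> rees_like_set C I" if "F \<in> rees_like_set C I" for F
    using that \<phi>D(1) \<phi>(2) p(2) by (auto simp: rees_like_set_def co)
  moreover have "?\<Phi> (F + G) = ?\<Phi> F + ?\<Phi> G"
    if "F \<in> rees_like_set C I" "G \<in> rees_like_set C I" for F G
    using that \<phi>D(2) by (intro poly_eqI) (auto simp: rees_like_set_def co)
  moreover have "?\<Phi> (A ^ p * G) = A * ?\<Phi> G"
    if "A \<in> rees_like_set C I" "G \<in> rees_like_set C I" for A G
  proof (rule poly_eqI)
    fix j
    have AG: "coeff A i \<in> C" "coeff G i \<in> C" for i using that by (auto simp: rees_like_set_def)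
    have "coeff (?\<Phi> (A ^ p * G)) j =
        \<phi> (\<Sum>i\<le>degree A. if i \<le> j then coeff A i ^ p * coeff G (p * (j - i)) else 0)"
      by (simp add: co coeff_frobenius_power_mult[OF p(1,3)])
    also have "\<dots> = (\<Sum>i\<le>degree A. \<phi> (if i \<le> j then coeff A i ^ p * coeff G (p * (j - i)) else 0))"
      using AG CD by (intro frobenius_splitting_sum[OF C \<phi>(1)]) auto
    also have "\<dots> = (\<Sum>i\<le>degree A. if i \<le> j then coeff A i * \<phi> (coeff G (p * (j - i))) else 0)"
      using AG by (intro sum.cong) (auto simp: \<phi>D(3) \<phi>0)
    also have "\<dots> = coeff ((\<Sum>i\<le>degree A. monom (coeff A i) i) * ?\<Phi> G) j"
      by (auto simp: sum_distrib_right coeff_sum coeff_monom_mult co intro!: sum.cong)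
    finally show "coeff (?\<Phi> (A ^ p * G)) j = coeff (A * ?\<Phi> G) j"
      by (simp add: poly_as_sum_of_monoms)
  qed
  moreover have "?\<Phi> 1 = 1"
    by (rule poly_eqI) (use p0 \<phi>0 \<phi>D(4) in \<open>auto simp: co\<close>)
  ultimately show ?thesis unfolding frobenius_splitting_def by blast
qed

section \<open>From the Rees-like algebra to the quotient\<close>

text \<open>
  The polynomials with all coefficients in \<open>I\<close> form the conductor of the Rees-like algebra in the
  full polynomial ring: they are the elements that stay in the algebra after multiplication by \<open>t\<close>.
  A splitting \<open>\<Phi>\<close> commutes with multiplication by \<open>t\<close> on the conductor, that is
  \<open>t * \<Phi> F = \<Phi> (t ^ p * F)\<close>, although \<open>t\<close> is not a scalar, because \<open>t\<close> is a quotient of the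
  scalars \<open>i * t\<close> and \<open>i\<close> for a nonzero \<open>i\<close> in \<open>I\<close>. The right side lies in the algebra, so \<open>\<Phi> F\<close>
  is in the conductor again. If \<open>I\<close> is zero, then so is the conductor.
\<close>

lemma splitting_preserves_conductor:
  fixes C :: "'a::idom set"
  assumes C: "unital_subring C" and I: "ideal I (type_ring C)"
    and \<Phi>: "frobenius_splitting p (rees_like_set C I) \<Phi>"
    and F: "\<And>k. coeff F k \<in> I"
  shows "coeff (\<Phi> F) k \<in> I"
proof (cases "I \<subseteq> {0}")
  case True
  hence "F = 0" using F by (intro poly_eqI) auto
  thus ?thesis
    using frobenius_splitting_0[OF unital_subring_rees_like[OF C I] \<Phi>] type_ring_idealD[OF C I] by simp
next
  case False
  then obtain i where i: "i \<in> I" "i \<noteq> 0" by blast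
  note CD = unital_subringD[OF C] and ID = type_ring_idealD[OF C I]
  let ?t = "[:0, 1:] :: 'a poly"
  have IC: "x \<in> C" if "x \<in> I" for x using that ID(1) by blast
  have in_RL: "G \<in> rees_like_set C I" if "\<And>k. coeff G k \<in> I" for G
    using that IC by (simp add: rees_like_set_def)
  have t_power: "?t ^ p = monom 1 p" by (simp add: monom_altdef)
  have tF: "?t ^ p * F \<in> rees_like_set C I"
    unfolding t_power using F ID(2) by (intro in_RL) (simp add: coeff_monom_mult)
  have iC: "[:i:] \<in> rees_like_set C I" "[:0, i:] \<in> rees_like_set C I"
    using i IC CD ID by (auto simp: rees_like_set_def coeff_pCons split: nat.splits)
  have lin: "\<Phi> (a ^ p * x) = a * \<Phi> x"
    if "a \<in> rees_like_set C I" "x \<in> rees_like_set C I" for a x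
    using \<Phi> that unfolding frobenius_splitting_def by blast
  \<comment> \<open>The factor \<open>i\<close> is what allows \<open>t\<close> to pass through \<open>\<Phi>\<close> as a scalar; it is cancelled below.\<close>
  have ti: "[:0, i:] = [:i:] * ?t" by simp
  have "[:i:] * (?t * \<Phi> F) = [:0, i:] * \<Phi> F" by (simp only: ti mult.assoc)
  also have "\<dots> = \<Phi> ([:0, i:] ^ p * F)" using lin[OF iC(2) in_RL[OF F]] by simp
  also have "[:0, i:] ^ p * F = [:i:] ^ p * (?t ^ p * F)"
    by (simp only: ti power_mult_distrib mult.assoc)
  also have "\<Phi> \<dots> = [:i:] * \<Phi> (?t ^ p * F)" by (rule lin[OF iC(1) tF])
  finally have "?t * \<Phi> F = \<Phi> (?t ^ p * F)" using i by (subst (asm) mult_left_cancel) auto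
  moreover have closed: "\<Phi> G \<in> rees_like_set C I" if "G \<in> rees_like_set C I" for G
    using \<Phi> that unfolding frobenius_splitting_def by blast
  ultimately have tPhi: "?t * \<Phi> F \<in> rees_like_set C I" using tF by simp
  have odd_coeff: "coeff G m \<in> I" if "G \<in> rees_like_set C I" "odd m" for G m
    using that by (simp add: rees_like_set_def)
  have "coeff (\<Phi> F) k \<in> I" if "even k"
    using odd_coeff[OF tPhi, of "Suc k"] that by simp
  moreover have "coeff (\<Phi> F) k \<in> I" if "odd k"
    using odd_coeff[OF closed[OF in_RL[OF F]] that] .
  ultimately show ?thesis by blast
qed

text \<open>
  The quotient of the Rees-like algebra by its conductor is the polynomial ring in \<open>t\<^sup>2\<close> over the quotient
  by \<open>I\<close>. The splitting descends there, and its restriction to constants followed by the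
  projection to constant terms splits Frobenius of the quotient by \<open>I\<close>.
\<close>

lemma frobenius_splitting_mod_of_rees_like:
  fixes C :: "'a::idom set"
  assumes C: "unital_subring C" and I: "ideal I (type_ring C)"
    and \<Phi>: "frobenius_splitting p (rees_like_set C I) \<Phi>"
  shows "frobenius_splitting_mod p C I (\<lambda>x. coeff (\<Phi> [:x:]) 0)"
proof -
  note CD = unital_subringD[OF C] and ID = type_ring_idealD[OF C I]
  have const: "[:x:] \<in> rees_like_set C I" if "x \<in> C" for x
    using that CD ID by (auto simp: rees_like_set_def coeff_pCons split: nat.splits)
  have \<Phi>D: "\<And>x. x \<in> rees_like_set C I \<Longrightarrow> \<Phi> x \<in> rees_like_set C I"
    "\<And>x y. x \<in> rees_like_set C I \<Longrightarrow> y \<in> rees_like_set C I \<Longrightarrow> \<Phi> (x + y) = \<Phi> x + \<Phi> y"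
    "\<And>a x. a \<in> rees_like_set C I \<Longrightarrow> x \<in> rees_like_set C I \<Longrightarrow> \<Phi> (a ^ p * x) = a * \<Phi> x"
    "\<Phi> 1 = 1"
    using \<Phi> unfolding frobenius_splitting_def by blast+
  have "coeff (\<Phi> [:x:]) 0 \<in> C" if "x \<in> C" for x
    using \<Phi>D(1)[OF const[OF that]] by (simp add: rees_like_set_def)
  moreover have "coeff (\<Phi> [:x:]) 0 \<in> I" if "x \<in> I" for x
    using that ID(2)
    by (intro splitting_preserves_conductor[OF C I \<Phi>]) (auto simp: coeff_pCons split: nat.splits)
  moreover have "\<Phi> [:x + y:] = \<Phi> [:x:] + \<Phi> [:y:]" if "x \<in> C" "y \<in> C" for x y
    using \<Phi>D(2)[OF const const, OF that] by simp
  moreover have "\<Phi> [:a ^ p * x:] = [:a:] * \<Phi> [:x:]" if "a \<in> C" "x \<in> C" for a x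
    using \<Phi>D(3)[OF const const, OF that] by (simp add: poly_const_pow mult.commute)
  moreover have "\<Phi> [:1:] = 1" using \<Phi>D(4) by (simp flip: one_pCons)
  ultimately show ?thesis using ID(2) by (auto simp: frobenius_splitting_mod_def)
qed

section \<open>F-splitness of Rees-like algebras\<close>

lemma mpoly_ring_conv: "mpoly_ring n = type_ring (mpoly_carrier n)"
  by (simp add: mpoly_ring_def)

lemma rees_like_algebra_conv:
  assumes "ideal I (mpoly_ring n)"
  shows "rees_like_algebra n I = type_ring (rees_like_set (mpoly_carrier n) I)"
  using generate_ring_rees_like[OF unital_subring_mpoly_carrier assms[unfolded mpoly_ring_conv]]
  by (simp add: rees_like_algebra_def mpoly_ring_t_def mpoly_ring_conv)

theorem theoremF:
  fixes n p :: nat and I :: "'k::field mpoly set"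
  assumes "CHAR('k) = p" and "p > 2"
    and "perfect_field TYPE('k)"
    and "radical_ideal I (mpoly_ring n)"
    and "homogeneous_ideal n I"
  shows "F_split p (mpoly_ring n Quot I) \<longleftrightarrow> F_split p (rees_like_algebra n I)"
proof -
  let ?C = "mpoly_carrier n :: 'k mpoly set"
  have p: "prime p" using assms(1,2) prime_CHAR_semidom[where ?'a='k] by simp
  have "odd p" using p assms(2) by (simp add: prime_odd_nat)
  have C: "unital_subring ?C" by (rule unital_subring_mpoly_carrier)
  have rad: "radical_ideal I (type_ring ?C)" using assms(4) by (simp only: mpoly_ring_conv)
  hence I: "ideal I (type_ring ?C)" by (simp only: radical_ideal_def)
  have "of_nat p = (0::'k)" using assms(1) of_nat_CHAR[where ?'a='k] by simp
  hence char: "of_nat p = (0::'k mpoly)" by (rule of_nat_poly_mapping_eq_0)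
  have "F_split p (mpoly_ring n Quot I) \<longleftrightarrow> (\<exists>\<phi>. frobenius_splitting_mod p ?C I \<phi>)"
    unfolding mpoly_ring_conv by (rule F_split_quotient_iff[OF C p char rad])
  also have "\<dots> \<longleftrightarrow> (\<exists>\<Phi>. frobenius_splitting p (rees_like_set ?C I) \<Phi>)"
  proof
    assume "\<exists>\<phi>. frobenius_splitting_mod p ?C I \<phi>"
    then obtain \<psi> where "frobenius_splitting p ?C \<psi>" "\<psi> \<in> I \<rightarrow> I"
      using lift_frobenius_splitting[OF assms(1) p assms(3) I] by blast
    thus "\<exists>\<Phi>. frobenius_splitting p (rees_like_set ?C I) \<Phi>"
      using frobenius_splitting_rees_like[OF C I p \<open>odd p\<close> char] by blast
  next
    assume "\<exists>\<Phi>. frobenius_splitting p (rees_like_set ?C I) \<Phi>"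
    thus "\<exists>\<phi>. frobenius_splitting_mod p ?C I \<phi>"
      using frobenius_splitting_mod_of_rees_like[OF C I] by blast
  qed
  also have "\<dots> \<longleftrightarrow> F_split p (type_ring (rees_like_set ?C I))"
    by (rule F_split_type_ring_iff[OF unital_subring_rees_like[OF C I] p of_nat_poly_eq_0[OF char], symmetric])
  also have "type_ring (rees_like_set ?C I) = rees_like_algebra n I"
    using rees_like_algebra_conv[of I n] I by (simp only: mpoly_ring_conv)
  finally show ?thesis .
qed

end
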